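(* Let $n = 7$, and let $G$ be a non-cyclic quotient of the braid group $B_n$. Then $|G| \geq n!$.
   Context: $B_n$ is the braid group on $n$ strands, with standard generators $\sigma_1,\dots,\sigma_{n-1}$ and relations $\sigma_i\sigma_j=\sigma_j\sigma_i$ for $|i-j|\ge 2$ and $\sigma_i\sigma_{i+1}\sigma_i=\sigma_{i+1}\sigma_i\sigma_{i+1}$. Its abelianization $B_n/B_n'$ is infinite cyclic. A homomorphism $B_n\to G$ is called cyclic if it factors through the abelianization $B_n \to B_n/B_n'\cong\mathbb{Z}$, and non-cyclic otherwise. A non-cyclic quotient of $B_n$ is a group $G$ for which there is a surjective non-cyclic homomorphism $B_n\to G$. If $G$ is infinite, the inequality is understood to hold. *)

theory Defs
  imports "HOL-Algebra.Algebra"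
begin

text \<open>The letter \<open>(s, True)\<close> stands for the generator \<open>s\<close> and \<open>(s, False)\<close> for its formal inverse.\<close>

type_synonym 's word = "('s \<times> bool) list"

definition words :: "'s set \<Rightarrow> 's word set" where
  "words S = lists (S \<times> UNIV)"

inductive word_equiv :: "'s set \<Rightarrow> ('s word \<times> 's word) set \<Rightarrow> 's word \<Rightarrow> 's word \<Rightarrow> bool"
  for S R where
  refl: "w \<in> words S \<Longrightarrow> word_equiv S R w w"
| sym: "word_equiv S R u v \<Longrightarrow> word_equiv S R v u"
| trans: "word_equiv S R u v \<Longrightarrow> word_equiv S R v w \<Longrightarrow> word_equiv S R u w"
| cong: "word_equiv S R u u' \<Longrightarrow> word_equiv S R v v' \<Longrightarrow> word_equiv S R (u @ v) (u' @ v')"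
| cancel: "s \<in> S \<Longrightarrow> word_equiv S R [(s, b), (s, \<not> b)] []"
| rel: "(u, v) \<in> R \<Longrightarrow> u \<in> words S \<Longrightarrow> v \<in> words S \<Longrightarrow> word_equiv S R u v"

definition word_class :: "'s set \<Rightarrow> ('s word \<times> 's word) set \<Rightarrow> 's word \<Rightarrow> 's word set" where
  "word_class S R w = {v. word_equiv S R w v}"

definition presented_group :: "'s set \<Rightarrow> ('s word \<times> 's word) set \<Rightarrow> 's word set monoid" where
  "presented_group S R =
     \<lparr>carrier = word_class S R ` words S,
      monoid.mult = (\<lambda>A B. \<Union>a\<in>A. \<Union>b\<in>B. word_class S R (a @ b)),
      one = word_class S R []\<rparr>"

lemma word_equiv_in_words:
  assumes "word_equiv S R u v"
  shows "u \<in> words S \<and> v \<in> words S"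
  using assms by induction (auto simp: words_def)

lemma word_class_eq_iff:
  assumes "u \<in> words S"
  shows "word_class S R u = word_class S R v \<longleftrightarrow> word_equiv S R u v"
proof
  assume "word_class S R u = word_class S R v"
  moreover have "u \<in> word_class S R u"
    using word_equiv.refl[OF assms] by (simp add: word_class_def)
  ultimately have "word_equiv S R v u"
    by (simp add: word_class_def)
  then show "word_equiv S R u v"
    by (rule word_equiv.sym)
next
  assume uv: "word_equiv S R u v"
  have "word_equiv S R u w \<longleftrightarrow> word_equiv S R v w" for w
    using word_equiv.trans[OF uv] word_equiv.trans[OF word_equiv.sym[OF uv]] by blast
  then show "word_class S R u = word_class S R v"
    by (simp add: word_class_def)
qed

lemma presented_group_mult:
  assumes "u \<in> words S" "v \<in> words S"
  shows "word_class S R u \<otimes>\<^bsub>presented_group S R\<^esub> word_class S R v = word_class S R (u @ v)"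
proof -
  have "u \<in> word_class S R u" "v \<in> word_class S R v"
    using assms by (auto simp: word_class_def intro: word_equiv.refl)
  moreover have "word_class S R (a @ b) = word_class S R (u @ v)"
    if "a \<in> word_class S R u" "b \<in> word_class S R v" for a b
  proof -
    have "word_equiv S R (u @ v) (a @ b)"
      using that by (auto simp: word_class_def intro: word_equiv.cong)
    moreover have "u @ v \<in> words S"
      using assms by (auto simp: words_def)
    ultimately show ?thesis
      by (simp add: word_class_eq_iff[symmetric])
  qed
  ultimately have "(\<Union>a\<in>word_class S R u. \<Union>b\<in>word_class S R v. word_class S R (a @ b)) =
      word_class S R (u @ v)"
    by blast
  then show ?thesis
    by (simp add: presented_group_def)
qed

definition inv_word :: "'s word \<Rightarrow> 's word" where
  "inv_word w = rev (map (\<lambda>(s, b). (s, \<not> b)) w)"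

lemma inv_word_cancel:
  assumes "w \<in> words S"
  shows "inv_word w \<in> words S \<and> word_equiv S R (inv_word w @ w) []"
  using assms
proof (induction w)
  case Nil
  then show ?case by (auto simp: inv_word_def words_def intro: word_equiv.refl)
next
  case (Cons x w)
  obtain s b where x: "x = (s, b)" by (cases x)
  have s: "s \<in> S" and w: "w \<in> words S"
    using Cons.prems by (auto simp: words_def x)
  note IH = Cons.IH[OF w]
  have "word_equiv S R [(s, \<not> b), (s, b)] []"
    using word_equiv.cancel[OF s, of R "\<not> b"] by simp
  from word_equiv.cong[OF this word_equiv.refl[OF w]]
  have "word_equiv S R ([(s, \<not> b), (s, b)] @ w) w"
    by simp
  from word_equiv.cong[OF word_equiv.refl[OF conjunct1[OF IH]] this]
  have "word_equiv S R (inv_word w @ [(s, \<not> b), (s, b)] @ w) []"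
    by (rule word_equiv.trans[OF _ conjunct2[OF IH]])
  then show ?case
    using s IH by (auto simp: inv_word_def x words_def)
qed

theorem group_presented_group: "group (presented_group S R)"
proof (rule groupI)
  let ?G = "presented_group S R"
  have carrier: "carrier ?G = word_class S R ` words S"
    and one: "\<one>\<^bsub>?G\<^esub> = word_class S R []"
    by (auto simp: presented_group_def)
  have append: "u @ v \<in> words S" if "u \<in> words S" "v \<in> words S" for u v
    using that by (auto simp: words_def)
  have Nil: "[] \<in> words S"
    by (simp add: words_def)
  show "\<one>\<^bsub>?G\<^esub> \<in> carrier ?G"
    using Nil by (simp add: carrier one)
  show "x \<otimes>\<^bsub>?G\<^esub> y \<in> carrier ?G" if "x \<in> carrier ?G" "y \<in> carrier ?G" for x y
    using that append by (auto simp: carrier presented_group_mult)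
  show "x \<otimes>\<^bsub>?G\<^esub> y \<otimes>\<^bsub>?G\<^esub> z = x \<otimes>\<^bsub>?G\<^esub> (y \<otimes>\<^bsub>?G\<^esub> z)"
    if "x \<in> carrier ?G" "y \<in> carrier ?G" "z \<in> carrier ?G" for x y z
    using that append by (auto simp: carrier presented_group_mult)
  show "\<one>\<^bsub>?G\<^esub> \<otimes>\<^bsub>?G\<^esub> x = x" if "x \<in> carrier ?G" for x
    using that Nil by (auto simp: carrier one presented_group_mult)
  show "\<exists>y\<in>carrier ?G. y \<otimes>\<^bsub>?G\<^esub> x = \<one>\<^bsub>?G\<^esub>" if x: "x \<in> carrier ?G" for x
  proof -
    obtain w where w: "w \<in> words S" "x = word_class S R w"
      using x by (auto simp: carrier)
    have "word_class S R (inv_word w) \<otimes>\<^bsub>?G\<^esub> x = \<one>\<^bsub>?G\<^esub>"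
      using w inv_word_cancel[OF w(1), of R] append
      by (simp add: one presented_group_mult word_class_eq_iff)
    then show ?thesis
      using inv_word_cancel[OF w(1)] by (auto simp: carrier)
  qed
qed

definition braid_relations :: "nat \<Rightarrow> (nat word \<times> nat word) set" where
  "braid_relations n =
     {([(i, True), (j, True)], [(j, True), (i, True)]) | i j.
        i \<in> {1..<n} \<and> j \<in> {1..<n} \<and> \<bar>int i - int j\<bar> \<ge> 2} \<union>
     {([(i, True), (i + 1, True), (i, True)], [(i + 1, True), (i, True), (i + 1, True)]) | i.
        i \<in> {1..<n} \<and> i + 1 \<in> {1..<n}}"

definition braid_group :: "nat \<Rightarrow> nat word set monoid" where
  "braid_group n = presented_group {1..<n} (braid_relations n)"

definition cyclic_hom :: "('a, 'b) monoid_scheme \<Rightarrow> ('c, 'd) monoid_scheme \<Rightarrow> ('a \<Rightarrow> 'c) \<Rightarrow> bool" where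
  "cyclic_hom B G \<phi> \<longleftrightarrow>
     (\<exists>\<psi> \<in> hom (B Mod derived B (carrier B)) G.
        \<forall>x \<in> carrier B. \<phi> x = \<psi> (derived B (carrier B) #>\<^bsub>B\<^esub> x))"

definition noncyclic_quotient :: "nat \<Rightarrow> ('a, 'b) monoid_scheme \<Rightarrow> bool" where
  "noncyclic_quotient n G \<longleftrightarrow>
     group G \<and> (\<exists>\<phi> \<in> epi (braid_group n) G. \<not> cyclic_hom (braid_group n) G \<phi>)"

end

theory Submission
  imports Defs
begin

text \<open>A non-cyclic homomorphism on a braid group sends adjacent generators to elements that do not
  commute: two commuting elements \<open>x\<close>, \<open>y\<close> with \<open>x y x = y x y\<close> are equal, and one such equality
  spreads along the strands until all generators have the same image
  (\<open>braid_chain_of_noncyclic_quotient\<close>). So it suffices to bound the order of a finite group \<open>G\<close>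
  that contains a \<^emph>\<open>braid chain\<close>: elements \<open>s 1, \<dots>, s (n - 1)\<close> that satisfy the braid relations and
  whose neighbours do not commute.

  The bound proved for odd \<open>n\<close> is \<open>n! \<cdot> |Z(G)| \<le> |G|\<close> (\<open>fact_mult_card_centre_le_order\<close>), by
  induction from \<open>n - 2\<close> to \<open>n\<close>, using that \<open>|G|\<close> is the product of the size of the conjugacy class
  of \<open>s 1\<close> and the order of its centralizer \<open>C\<close>. In the symmetric group, these factors are the
  number of transpositions and \<open>2 \<cdot> (n - 2)!\<close>; in general they are at least as large.

  The class contains the half twists on two strands \<open>i < j\<close>. Such a half twist commutes with \<open>s k\<close>
  exactly when the corresponding transpositions commute, that is, when both or neither
  of \<open>k\<close>, \<open>k + 1\<close> lie in \<open>{i, j}\<close> (\<open>commute_band_iff\<close>). This determines \<open>{i, j}\<close> up to complement in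
  \<open>{1..n}\<close>, so for \<open>n \<noteq> 4\<close> the \<open>n (n - 1) / 2\<close> half twists are distinct (\<open>band_inject\<close>).

  The centralizer contains the braid chain \<open>s 3, \<dots>, s (n - 1)\<close> on \<open>n - 2\<close> strands, so the induction
  hypothesis gives \<open>(n - 2)! \<cdot> |Z(C)| \<le> |C|\<close>. The missing factor 2 comes from the centre: \<open>Z(C)\<close>
  contains \<open>Z(G)\<close> and also \<open>s 1\<close>, which is not in \<open>Z(G)\<close>
  (\<open>two_card_centre_le_card_centre_centralizer\<close>). The factor \<open>|Z(G)|\<close> in the bound is what lets
  the induction see this gain without having to know how \<open>s 1\<close> lies relative to the subgroup
  generated by \<open>s 3, \<dots>, s (n - 1)\<close>.\<close>

section \<open>Conjugation and commuting elements\<close>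

definition conjugate :: "('a, 'b) monoid_scheme \<Rightarrow> 'a \<Rightarrow> 'a \<Rightarrow> 'a" where
  "conjugate G g x = g \<otimes>\<^bsub>G\<^esub> x \<otimes>\<^bsub>G\<^esub> inv\<^bsub>G\<^esub> g"

definition commute :: "('a, 'b) monoid_scheme \<Rightarrow> 'a \<Rightarrow> 'a \<Rightarrow> bool" where
  "commute G x y \<longleftrightarrow> x \<otimes>\<^bsub>G\<^esub> y = y \<otimes>\<^bsub>G\<^esub> x"

definition centralizer :: "('a, 'b) monoid_scheme \<Rightarrow> 'a \<Rightarrow> 'a set" where
  "centralizer G x = {g \<in> carrier G. commute G g x}"

definition centre :: "('a, 'b) monoid_scheme \<Rightarrow> 'a set" where
  "centre G = {z \<in> carrier G. \<forall>g \<in> carrier G. commute G z g}"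

definition conj_class :: "('a, 'b) monoid_scheme \<Rightarrow> 'a \<Rightarrow> 'a set" where
  "conj_class G x = (\<lambda>g. conjugate G g x) ` carrier G"

lemma commute_refl: "commute G x x"
  by (simp add: commute_def)

lemma commute_sym: "commute G x y \<longleftrightarrow> commute G y x"
  by (auto simp: commute_def)

context group
begin

lemma conjugate_closed: "g \<in> carrier G \<Longrightarrow> x \<in> carrier G \<Longrightarrow> conjugate G g x \<in> carrier G"
  by (simp add: conjugate_def)

lemma conjugate_one: "x \<in> carrier G \<Longrightarrow> conjugate G \<one> x = x"
  by (simp add: conjugate_def)

lemma conjugate_mult_left:
  assumes "g \<in> carrier G" "h \<in> carrier G" "x \<in> carrier G"
  shows "conjugate G (g \<otimes> h) x = conjugate G g (conjugate G h x)"
  using assms by (simp add: conjugate_def inv_mult_group m_assoc)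

lemma conjugate_mult_right:
  assumes "g \<in> carrier G" "x \<in> carrier G" "y \<in> carrier G"
  shows "conjugate G g (x \<otimes> y) = conjugate G g x \<otimes> conjugate G g y"
proof -
  have "inv g \<otimes> (g \<otimes> (y \<otimes> inv g)) = y \<otimes> inv g"
    using assms by (simp flip: m_assoc)
  then show ?thesis
    using assms by (simp add: conjugate_def m_assoc)
qed

lemma conjugate_inject:
  assumes "g \<in> carrier G" "x \<in> carrier G" "y \<in> carrier G"
  shows "conjugate G g x = conjugate G g y \<longleftrightarrow> x = y"
  using assms by (simp add: conjugate_def)

lemma conjugate_eq_iff:
  assumes "g \<in> carrier G" "x \<in> carrier G" "y \<in> carrier G"
  shows "conjugate G g x = y \<longleftrightarrow> g \<otimes> x = y \<otimes> g"
  using assms by (metis conjugate_def inv_solve_right' m_closed)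

lemma conjugate_fixed_iff:
  assumes "g \<in> carrier G" "x \<in> carrier G"
  shows "conjugate G g x = x \<longleftrightarrow> commute G g x"
  using assms by (simp add: conjugate_eq_iff commute_def)

lemma commute_conj_iff:
  assumes "g \<in> carrier G" "x \<in> carrier G" "y \<in> carrier G"
  shows "commute G (conjugate G g x) (conjugate G g y) \<longleftrightarrow> commute G x y"
  using assms by (simp add: commute_def conjugate_inject flip: conjugate_mult_right)

text \<open>The braid relation says that conjugation by \<open>x y\<close> takes \<open>x\<close> to \<open>y\<close>. In this form it serves to
  write a generator as a conjugate, so that a common conjugating element can be cancelled in a
  commutation problem.\<close>

lemma conjugate_conj_eq_of_braid:
  assumes "x \<in> carrier G" "y \<in> carrier G" "x \<otimes> y \<otimes> x = y \<otimes> x \<otimes> y"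
  shows "conjugate G x (conjugate G y x) = y"
  using assms by (simp add: conjugate_eq_iff m_assoc flip: conjugate_mult_left)

lemma eq_of_braid_commute:
  assumes "x \<in> carrier G" "y \<in> carrier G" "x \<otimes> y \<otimes> x = y \<otimes> x \<otimes> y" "commute G x y"
  shows "x = y"
proof -
  have "(x \<otimes> y) \<otimes> x = (x \<otimes> y) \<otimes> y"
    using assms by (simp add: commute_def)
  then show ?thesis
    using assms by simp
qed

lemma conj_in_conj_class:
  assumes "x \<in> carrier G" "g \<in> carrier G" "y \<in> conj_class G x"
  shows "conjugate G g y \<in> conj_class G x"
  using assms by (auto simp: conj_class_def simp flip: conjugate_mult_left)

lemma self_in_conj_class: "x \<in> carrier G \<Longrightarrow> x \<in> conj_class G x"
  by (metis conj_class_def conjugate_one image_eqI one_closed)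

lemma centralizer_subgroup:
  assumes x: "x \<in> carrier G"
  shows "subgroup (centralizer G x) G"
proof (rule subgroupI)
  show "centralizer G x \<subseteq> carrier G" "centralizer G x \<noteq> {}"
    using x by (auto simp: centralizer_def commute_def)
next
  fix a assume "a \<in> centralizer G x"
  then have "a \<in> carrier G" "conjugate G a x = x"
    using x by (auto simp: centralizer_def conjugate_fixed_iff)
  then have "inv a \<in> carrier G" "conjugate G (inv a) x = x"
    using x conjugate_mult_left[of "inv a" a x] by (auto simp: conjugate_one)
  then show "inv a \<in> centralizer G x"
    using x by (simp add: centralizer_def flip: conjugate_fixed_iff)
next
  fix a b assume "a \<in> centralizer G x" "b \<in> centralizer G x"
  then show "a \<otimes> b \<in> centralizer G x"
    using x by (auto simp: centralizer_def conjugate_mult_left simp flip: conjugate_fixed_iff)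
qed

lemma centre_subgroup: "subgroup (centre G) G"
proof -
  have "centre G = carrier G \<inter> (\<Inter>x\<in>carrier G. centralizer G x)"
    by (auto simp: centre_def centralizer_def)
  also have "\<dots> = (\<Inter>x\<in>carrier G. centralizer G x)"
    using one_closed by (auto simp: centralizer_def)
  finally show ?thesis
    using centralizer_subgroup one_closed by (auto intro!: subgroups_Inter)
qed

text \<open>The orbit-stabilizer theorem for the action by conjugation.\<close>

lemma card_conj_class_mult_centralizer:
  assumes x: "x \<in> carrier G"
  shows "card (conj_class G x) * card (centralizer G x) = order G"
proof -
  let ?act = "\<lambda>g. \<lambda>h \<in> carrier G. g \<otimes> h \<otimes> inv g"
  interpret group_action G "carrier G" ?act
    by (rule action_by_conjugation)
  have "orbit G ?act x = conj_class G x"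
    using x by (auto simp: orbit_def conj_class_def conjugate_def)
  moreover have "stabilizer G ?act x = centralizer G x"
    using x by (auto simp: stabilizer_def centralizer_def simp flip: conjugate_fixed_iff)
      (auto simp: conjugate_def)
  ultimately show ?thesis
    using orbit_stabilizer_theorem[OF x] by simp
qed

text \<open>The two cosets \<open>Z\<close> and \<open>x Z\<close> of the centre \<open>Z\<close> are disjoint, and both are central in the
  centralizer of \<open>x\<close>.\<close>

lemma two_card_centre_le_card_centre_centralizer:
  assumes fin: "finite (carrier G)" and x: "x \<in> carrier G" and nc: "x \<notin> centre G"
  shows "2 * card (centre G) \<le> card (centre (G\<lparr>carrier := centralizer G x\<rparr>))"
proof -
  let ?Z = "centre G" and ?C = "centralizer G x"
  let ?K = "G\<lparr>carrier := ?C\<rparr>"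
  have Z: "?Z \<subseteq> carrier G"
    by (auto simp: centre_def)
  have finZ: "finite ?Z"
    using fin Z by (rule finite_subset[rotated])
  have xC: "x \<in> ?C"
    using x by (simp add: centralizer_def commute_refl)
  have ZC: "?Z \<subseteq> ?C"
    using x by (auto simp: centre_def centralizer_def)
  have "?Z \<subseteq> centre ?K"
    using ZC by (auto simp: centre_def commute_def centralizer_def)
  moreover have "x \<in> centre ?K"
    using xC by (auto simp: centre_def commute_def centralizer_def)
  moreover have "subgroup (centre ?K) ?K"
    by (rule group.centre_subgroup[OF subgroup.subgroup_is_group[OF centralizer_subgroup[OF x] is_group]])
  ultimately have "?Z \<union> (\<lambda>z. x \<otimes> z) ` ?Z \<subseteq> centre ?K"
    using subgroup.m_closed[of "centre ?K" ?K x] by auto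
  moreover have "finite (centre ?K)"
    using fin by (rule finite_subset[rotated]) (auto simp: centre_def centralizer_def)
  ultimately have "card (?Z \<union> (\<lambda>z. x \<otimes> z) ` ?Z) \<le> card (centre ?K)"
    by (rule card_mono[rotated])
  moreover have "?Z \<inter> (\<lambda>z. x \<otimes> z) ` ?Z = {}"
  proof -
    have False if "z \<in> ?Z" "x \<otimes> z \<in> ?Z" for z
    proof -
      have "x \<otimes> z \<otimes> inv z \<in> ?Z"
        using that subgroup.m_closed[OF centre_subgroup] subgroup.m_inv_closed[OF centre_subgroup]
        by blast
      then show False
        using nc x that Z by (simp add: m_assoc subsetD)
    qed
    then show ?thesis by blast
  qed
  moreover have "card ((\<lambda>z. x \<otimes> z) ` ?Z) = card ?Z"
    using x Z by (intro card_image inj_onI) (simp add: subsetD)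
  ultimately show ?thesis
    using finZ by (simp add: card_Un_disjoint)
qed

end

section \<open>Chains of braiding elements\<close>

text \<open>The indices run over \<open>{1..<n}\<close>, so \<open>n\<close> is the number of strands and not the number of elements.\<close>

locale braid_tuple = group G for G (structure) +
  fixes n :: nat and s :: "nat \<Rightarrow> 'a"
  assumes closed: "i \<in> {1..<n} \<Longrightarrow> s i \<in> carrier G"
    and far: "i \<in> {1..<n} \<Longrightarrow> j \<in> {1..<n} \<Longrightarrow> i + 2 \<le> j \<Longrightarrow> commute G (s i) (s j)"
    and braid: "i \<in> {1..<n} \<Longrightarrow> i + 1 \<in> {1..<n} \<Longrightarrow>
      s i \<otimes> s (i + 1) \<otimes> s i = s (i + 1) \<otimes> s i \<otimes> s (i + 1)"
begin

lemma far_sym: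
  assumes "i \<in> {1..<n}" "j \<in> {1..<n}" "i + 2 \<le> j \<or> j + 2 \<le> i"
  shows "commute G (s i) (s j)"
  using assms far commute_sym by metis

lemma braid_conj:
  assumes "i \<in> {1..<n}" "i + 1 \<in> {1..<n}"
  shows "conjugate G (s i) (conjugate G (s (i + 1)) (s i)) = s (i + 1)"
    and "conjugate G (s (i + 1)) (conjugate G (s i) (s (i + 1))) = s i"
  using conjugate_conj_eq_of_braid[OF closed closed braid]
    conjugate_conj_eq_of_braid[OF closed closed braid[symmetric]] assms by blast+

text \<open>If \<open>s i = s (i + 1)\<close>, then \<open>s (i + 2)\<close> commutes with \<open>s (i + 1)\<close>, because it commutes with \<open>s i\<close>;
  being braided with it as well, it equals it. The same argument runs downwards.\<close>

lemma constant_of_adjacent_commute: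
  assumes i: "i \<in> {1..<n}" "i + 1 \<in> {1..<n}" and comm: "commute G (s i) (s (i + 1))"
    and j: "j \<in> {1..<n}"
  shows "s j = s i"
proof -
  have eq: "s (k + 1) = s k" if "k \<in> {1..<n}" "k + 1 \<in> {1..<n}" "commute G (s k) (s (k + 1))" for k
    using eq_of_braid_commute[OF closed closed braid] that by metis
  have up: "s (i + d) = s i \<and> (i + d + 1 < n \<longrightarrow> s (i + d + 1) = s i)" if "i + d < n" for d
    using that
  proof (induction d)
    case 0
    then show ?case using eq[OF i comm] by simp
  next
    case (Suc d)
    then have *: "s (i + d) = s i" "s (i + d + 1) = s i" by auto
    have "s (i + d + 1 + 1) = s (i + d + 1)" if "i + d + 2 < n"
    proof (rule eq)
      show "commute G (s (i + d + 1)) (s (i + d + 1 + 1))"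
        using far[of "i + d" "i + d + 2"] i that * by simp
    qed (use i that in auto)
    then show ?case using * by simp
  qed
  have down: "s (i - d) = s i \<and> s (i - d + 1) = s i" if "d < i" for d
    using that
  proof (induction d)
    case 0
    then show ?case using eq[OF i comm] by simp
  next
    case (Suc d)
    define k where "k = i - Suc d"
    have k: "k \<ge> 1" "i - d = k + 1" "k + 2 < n" using Suc.prems i by (auto simp: k_def)
    have *: "s (k + 1) = s i" "s (k + 2) = s i" using Suc k by auto
    have "commute G (s k) (s (k + 1))"
      using far[of k "k + 2"] k * by simp
    then have "s (k + 1) = s k" using eq[of k] k by simp
    then show ?case using * by (simp add: k_def)
  qed
  show ?thesis
  proof (cases "i \<le> j")
    case True
    then show ?thesis using up[of "j - i"] j by simp
  next
    case False
    then show ?thesis using down[of "i - j"] j by simp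
  qed
qed

end

locale braid_chain = braid_tuple +
  assumes adj: "i \<in> {1..<n} \<Longrightarrow> i + 1 \<in> {1..<n} \<Longrightarrow> \<not> commute G (s i) (s (i + 1))"
begin

text \<open>\<open>band i d\<close> is the half twist that exchanges the strands \<open>i\<close> and \<open>i + d + 1\<close>, passing on one side of
  the \<open>d\<close> strands in between. It lies over the transposition of \<open>i\<close> and \<open>i + d + 1\<close>.\<close>

fun band :: "nat \<Rightarrow> nat \<Rightarrow> 'a" where
  "band i 0 = s i"
| "band i (Suc d) = conjugate G (s (i + d + 1)) (band i d)"

lemma band_closed: "1 \<le> i \<Longrightarrow> i + d < n \<Longrightarrow> band i d \<in> carrier G"
  by (induction d) (auto intro!: closed conjugate_closed)

text \<open>Geometrically, \<open>s k\<close> and the half twist belong to arcs that are disjoint, equal, or share one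
  endpoint; only in the last case do they fail to commute. The proof is by induction on \<open>d\<close>. Away
  from the right end, the outermost letter \<open>u\<close> commutes with \<open>s k\<close> and is conjugated away. Near the
  right end, \<open>s k\<close> is \<open>u\<close> itself or braided with \<open>u\<close>; then the braid relation rewrites \<open>s k\<close> as a
  conjugate by the same element as the half twist, which leaves a question about \<open>u\<close> and a shorter
  half twist.\<close>

lemma commute_band_iff:
  assumes i: "1 \<le> i" and d: "i + d < n" and k: "k \<in> {1..<n}"
  shows "commute G (s k) (band i d) \<longleftrightarrow>
    (k \<in> {i, i + d + 1} \<longleftrightarrow> k + 1 \<in> {i, i + d + 1})"
  using d k
proof (induction d arbitrary: k rule: less_induct)
  case (less d)
  show ?case
  proof (cases d)
    case 0
    consider "k = i" | "k = i + 1" | "i = k + 1" | "k + 2 \<le> i \<or> i + 2 \<le> k" by linarith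
    then show ?thesis
    proof cases
      case 1
      then show ?thesis using 0 by (simp add: commute_refl)
    next
      case 2
      then show ?thesis using 0 adj[of i] commute_sym[of G "s i"] i less.prems by simp
    next
      case 3
      then show ?thesis using 0 adj[of k] less.prems by simp
    next
      case 4
      then show ?thesis using 0 far_sym[of k i] less.prems i by auto
    qed
  next
    case (Suc e)
    let ?u = "s (i + e + 1)" and ?a = "band i e"
    have u: "?u \<in> carrier G" and a: "?a \<in> carrier G" and sk: "s k \<in> carrier G"
      using less.prems Suc i by (auto intro!: closed band_closed)
    have IH: "commute G (s l) ?a \<longleftrightarrow> (l \<in> {i, i + e + 1} \<longleftrightarrow> l + 1 \<in> {i, i + e + 1})"
      if "l \<in> {1..<n}" for l
      using less.IH[of e l] Suc less.prems that by simp
    consider "k = i + e + 2" | "k = i + e + 1" | "k = i + e" "e = 0" | f where "k = i + e" "e = Suc f"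
      | "k + 2 \<le> i + e + 1 \<or> i + e + 1 + 2 \<le> k"
    proof -
      consider "k = i + e + 2" | "k = i + e + 1" | "k = i + e" | "k + 2 \<le> i + e + 1 \<or> i + e + 1 + 2 \<le> k"
        by linarith
      then show thesis
        using that by cases (auto intro: not0_implies_Suc elim: nat.exhaust)
    qed
    then show ?thesis
    proof cases
      case 1
      have "conjugate G (s k) ?a = ?a"
        using IH[of k] 1 a sk less.prems by (simp add: conjugate_fixed_iff)
      moreover have "conjugate G ?u (conjugate G (s k) ?u) = s k"
        using braid_conj(1)[of "i + e + 1"] 1 less.prems by simp
      ultimately have "commute G (s k) (band i d) \<longleftrightarrow>
          commute G (conjugate G ?u (conjugate G (s k) ?u)) (conjugate G ?u (conjugate G (s k) ?a))"
        using Suc by simp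
      also have "\<dots> \<longleftrightarrow> commute G ?u ?a"
        using u a sk by (simp add: commute_conj_iff conjugate_closed)
      finally show ?thesis
        using IH[of "i + e + 1"] 1 Suc less.prems by simp
    next
      case 2
      have "commute G (s k) (band i d) \<longleftrightarrow> commute G (conjugate G ?u ?u) (conjugate G ?u ?a)"
        using Suc 2 u conjugate_fixed_iff[of ?u ?u] by (simp add: commute_refl)
      also have "\<dots> \<longleftrightarrow> commute G ?u ?a"
        using u a by (simp add: commute_conj_iff)
      finally show ?thesis
        using IH[of k] 2 Suc less.prems by simp
    next
      case 3
      have "commute G (s k) (band i d) \<longleftrightarrow>
          commute G (conjugate G ?u (conjugate G (s k) ?u)) (conjugate G ?u (conjugate G (s k) (s k)))"
        using Suc 3 braid_conj(2)[of k] less.prems sk conjugate_fixed_iff[of "s k" "s k"]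
        by (simp add: commute_refl)
      also have "\<dots> \<longleftrightarrow> commute G ?u (s k)"
        using u sk by (simp add: commute_conj_iff conjugate_closed)
      finally show ?thesis
        using adj[of k] commute_sym[of G ?u] 3 Suc less.prems by simp
    next
      case 4
      have b: "band i f \<in> carrier G"
        using less.prems Suc 4 i by (auto intro!: band_closed)
      have "commute G (s k) (band i d) \<longleftrightarrow>
          commute G (conjugate G ?u (conjugate G (s k) ?u)) (conjugate G ?u (conjugate G (s k) (band i f)))"
        using Suc 4 braid_conj(2)[of k] less.prems by simp
      also have "\<dots> \<longleftrightarrow> commute G ?u (band i f)"
        using u sk b by (simp add: commute_conj_iff conjugate_closed)
      finally show ?thesis
        using less.IH[of f "i + e + 1"] 4 Suc less.prems by simp
    next
      case 5
      have "commute G ?u (s k)"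
        using 5 less.prems Suc by (intro far_sym) auto
      then have "conjugate G ?u (s k) = s k"
        using u sk by (simp add: conjugate_fixed_iff)
      then have "commute G (s k) (band i d) \<longleftrightarrow> commute G (conjugate G ?u (s k)) (conjugate G ?u ?a)"
        using Suc by simp
      also have "\<dots> \<longleftrightarrow> commute G (s k) ?a"
        using u a sk by (simp add: commute_conj_iff)
      finally have "commute G (s k) (band i d) \<longleftrightarrow> commute G (s k) ?a" .
      moreover have "k \<in> {i, i + e + 1} \<longleftrightarrow> k \<in> {i, i + d + 1}"
          "k + 1 \<in> {i, i + e + 1} \<longleftrightarrow> k + 1 \<in> {i, i + d + 1}"
        using 5 Suc by auto
      ultimately show ?thesis
        using IH[OF less.prems(2)] by simp
    qed
  qed
qed

lemma gen_in_conj_class: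
  assumes "i \<in> {1..<n}"
  shows "s i \<in> conj_class G (s 1)"
proof -
  have "1 \<le> i" using assms by simp
  then show ?thesis
    using assms
  proof (induction rule: dec_induct)
    case base
    then show ?case by (simp add: self_in_conj_class closed)
  next
    case (step j)
    then have "conjugate G (s j) (conjugate G (s (j + 1)) (s j)) \<in> conj_class G (s 1)"
      by (intro conj_in_conj_class closed step.IH) auto
    then show ?case
      using braid_conj(1)[of j] step by simp
  qed
qed

lemma band_in_conj_class: "1 \<le> i \<Longrightarrow> i + d < n \<Longrightarrow> band i d \<in> conj_class G (s 1)"
proof (induction d)
  case 0
  then show ?case using gen_in_conj_class[of i] by simp
next
  case (Suc d)
  then show ?case by (auto intro!: conj_in_conj_class closed)
qed

text \<open>Write \<open>P\<close> and \<open>Q\<close> for the two pairs of strands. The generators that commute with the half twist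
  tell for which \<open>k\<close> the membership in the pair changes between \<open>k\<close> and \<open>k + 1\<close>. So \<open>P\<close> and \<open>Q\<close> agree
  everywhere or nowhere, and in the latter case \<open>{1..n}\<close> is their disjoint union and has four
  elements. For \<open>n = 4\<close> this does happen: the surjection from \<open>S\<^sub>4\<close> onto \<open>S\<^sub>3\<close> identifies complementary
  transpositions.\<close>

lemma band_inject:
  assumes n: "n \<noteq> 4" and i: "1 \<le> i" "i + d < n" and j: "1 \<le> j" "j + e < n"
    and eq: "band i d = band j e"
  shows "i = j \<and> d = e"
proof -
  let ?P = "{i, i + d + 1}" and ?Q = "{j, j + e + 1}"
  have adjacent: "(k \<in> ?P \<longleftrightarrow> k + 1 \<in> ?P) \<longleftrightarrow> (k \<in> ?Q \<longleftrightarrow> k + 1 \<in> ?Q)" if "k \<in> {1..<n}" for k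
    using commute_band_iff[OF i that] commute_band_iff[OF j that] eq by simp
  have agree: "(k \<in> ?P \<longleftrightarrow> k \<in> ?Q) \<longleftrightarrow> (1 \<in> ?P \<longleftrightarrow> 1 \<in> ?Q)" if "1 \<le> k" "k \<le> n" for k
    using that
  proof (induction rule: dec_induct)
    case (step m)
    then show ?case using adjacent[of m] by auto
  qed simp
  show ?thesis
  proof (cases "1 \<in> ?P \<longleftrightarrow> 1 \<in> ?Q")
    case True
    then have "k \<in> ?P \<longleftrightarrow> k \<in> ?Q" if "k \<in> {1..n}" for k
      using agree[of k] that by auto
    moreover have "?P \<subseteq> {1..n}" "?Q \<subseteq> {1..n}"
      using i j by auto
    ultimately have "?P = ?Q"
      by blast
    then show ?thesis by (auto simp: doubleton_eq_iff)
  next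
    case False
    then have "k \<in> ?P \<longleftrightarrow> k \<notin> ?Q" if "k \<in> {1..n}" for k
      using agree[of k] that by auto
    moreover have "?P \<subseteq> {1..n}" "?Q \<subseteq> {1..n}"
      using i j by auto
    ultimately have "?P \<inter> ?Q = {}" "?P \<union> ?Q = {1..n}"
      by blast+
    then have "card {1..n} = card ?P + card ?Q"
      by (metis card_Un_disjoint finite.emptyI finite.insertI)
    then show ?thesis using n by simp
  qed
qed

lemma card_conj_class_ge:
  assumes fin: "finite (carrier G)" and n: "n \<noteq> 4" "1 < n"
  shows "n * (n - 1) \<le> 2 * card (conj_class G (s 1))"
proof -
  let ?I = "SIGMA i:{1..n}. {..<n - i}"
  have "inj_on (\<lambda>(i, d). band i d) ?I"
    by (auto simp: inj_on_def dest!: band_inject[OF n(1), rotated -1])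
  then have "card ?I = card ((\<lambda>(i, d). band i d) ` ?I)"
    by (simp add: card_image)
  also have "\<dots> \<le> card (conj_class G (s 1))"
  proof (rule card_mono)
    show "finite (conj_class G (s 1))"
      using fin by (simp add: conj_class_def)
    show "(\<lambda>(i, d). band i d) ` ?I \<subseteq> conj_class G (s 1)"
      by (auto intro!: band_in_conj_class simp del: One_nat_def)
  qed
  finally have "card ?I \<le> card (conj_class G (s 1))" .
  moreover have "2 * card ?I = n * (n - 1)"
  proof -
    have "card ?I = (\<Sum>i=1..n. n - i)" by simp
    also have "\<dots> = (\<Sum>i<n. i)"
      by (rule sum.reindex_bij_witness[of _ "\<lambda>i. n - i" "\<lambda>i. n - i"]) auto
    also have "2 * \<dots> = n * (n - 1)"
      by (induction n) (auto simp: algebra_simps)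
    finally show ?thesis .
  qed
  ultimately show ?thesis by linarith
qed

end

section \<open>The order of a group containing a braid chain\<close>

lemma braid_chain_centralizer:
  assumes "braid_chain G (n + 2) s"
  shows "braid_chain (G\<lparr>carrier := centralizer G (s 1)\<rparr>) n (\<lambda>i. s (i + 2))"
proof -
  interpret braid_chain G "n + 2" s by fact
  have s1: "s 1 \<in> carrier G" by (simp add: closed)
  have in_centralizer: "s (i + 2) \<in> centralizer G (s 1)" if "i \<in> {1..<n}" for i
    using that closed[of "i + 2"] far_sym[of "i + 2" 1] by (simp add: centralizer_def)
  have "group (G\<lparr>carrier := centralizer G (s 1)\<rparr>)"
    by (rule subgroup.subgroup_is_group[OF centralizer_subgroup[OF s1] is_group])
  then show ?thesis
  proof (intro braid_chain.intro braid_tuple.intro braid_tuple_axioms.intro braid_chain_axioms.intro)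
    fix i j assume "i \<in> {1..<n}" "j \<in> {1..<n}" "i + 2 \<le> j"
    then show "commute (G\<lparr>carrier := centralizer G (s 1)\<rparr>) (s (i + 2)) (s (j + 2))"
      using far[of "i + 2" "j + 2"] by (simp add: commute_def)
  next
    fix i assume "i \<in> {1..<n}" "i + 1 \<in> {1..<n}"
    then show "\<not> commute (G\<lparr>carrier := centralizer G (s 1)\<rparr>) (s (i + 2)) (s (i + 1 + 2))"
      using adj[of "i + 2"] by (simp add: commute_def)
  next
    fix i assume "i \<in> {1..<n}" "i + 1 \<in> {1..<n}"
    then show "s (i + 2) \<otimes>\<^bsub>G\<lparr>carrier := centralizer G (s 1)\<rparr>\<^esub> s (i + 1 + 2)
        \<otimes>\<^bsub>G\<lparr>carrier := centralizer G (s 1)\<rparr>\<^esub> s (i + 2) =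
        s (i + 1 + 2) \<otimes>\<^bsub>G\<lparr>carrier := centralizer G (s 1)\<rparr>\<^esub> s (i + 2)
        \<otimes>\<^bsub>G\<lparr>carrier := centralizer G (s 1)\<rparr>\<^esub> s (i + 1 + 2)"
      using braid[of "i + 2"] by simp
  qed (use in_centralizer in simp_all)
qed

text \<open>For \<open>n = 4\<close> the inequality can fail: the images of the generators of \<open>B\<^sub>4\<close> in \<open>S\<^sub>3\<close> form a braid
  chain. Steps of two through the odd numbers avoid this case; they start from \<open>n = 1\<close>, where the
  chain is empty and the inequality says that the centre is contained in the group.\<close>

theorem fact_mult_card_centre_le_order:
  fixes G :: "('a, 'b) monoid_scheme"
  assumes "odd n" "finite (carrier G)" "braid_chain G n s"
  shows "fact n * card (centre G) \<le> order G"
proof -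
  obtain m where "n = 2 * m + 1"
    using \<open>odd n\<close> by (elim oddE)
  then show ?thesis
    using assms(2,3)
  proof (induction m arbitrary: n G s)
    case 0
    have "centre G \<subseteq> carrier G"
      by (auto simp: centre_def)
    then show ?case
      using 0 by (simp add: order_def card_mono)
  next
    case (Suc m)
    define k where "k = 2 * m + 1"
    have n: "n = k + 2"
      using Suc.prems(1) by (simp add: k_def)
    interpret braid_chain G n s by fact
    let ?C = "centralizer G (s 1)"
    have s1: "s 1 \<in> carrier G" and s2: "s 2 \<in> carrier G"
      using closed[of 1] closed[of 2] n by (simp_all add: k_def)
    have "s 1 \<notin> centre G"
      using adj[of 1] s2 n by (auto simp: centre_def k_def numeral_2_eq_2)
    then have "fact k * (2 * card (centre G)) \<le> fact k * card (centre (G\<lparr>carrier := ?C\<rparr>))"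
      using two_card_centre_le_card_centre_centralizer[OF Suc.prems(2) s1] by simp
    also have "\<dots> \<le> order (G\<lparr>carrier := ?C\<rparr>)"
    proof (rule Suc.IH[OF k_def])
      show "finite (carrier (G\<lparr>carrier := ?C\<rparr>))"
        using Suc.prems(2) by (simp add: centralizer_def)
      show "braid_chain (G\<lparr>carrier := ?C\<rparr>) k (\<lambda>i. s (i + 2))"
        using Suc.prems(3) n by (intro braid_chain_centralizer) simp
    qed
    finally have C: "fact k * (2 * card (centre G)) \<le> card ?C"
      by (simp add: order_def)
    have "n \<noteq> 4" "1 < n"
      using n unfolding k_def by presburger+
    then have "n * (n - 1) \<le> 2 * card (conj_class G (s 1))"
      by (rule card_conj_class_ge[OF Suc.prems(2)])
    then have "(n * (n - 1)) * (fact k * (2 * card (centre G))) \<le> (2 * card (conj_class G (s 1))) * card ?C"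
      using C by (rule mult_le_mono)
    also have "\<dots> = 2 * order G"
      using card_conj_class_mult_centralizer[OF s1] by simp
    finally have "n * (n - 1) * fact k * card (centre G) \<le> order G"
      by simp
    moreover have "fact n = n * (n - 1) * (fact k :: nat)"
      by (simp add: n algebra_simps)
    ultimately show ?case
      by simp
  qed
qed

section \<open>Quotients of braid groups\<close>

text \<open>The centralizer of an element is a subgroup, so it contains the whole image as soon as it
  contains the images of the generators. This is used twice, once for each argument.\<close>

lemma presented_hom_commute:
  assumes hom: "\<phi> \<in> hom (presented_group S R) G" and G: "group G"
    and comm: "\<And>i j. i \<in> S \<Longrightarrow> j \<in> S \<Longrightarrow>
      commute G (\<phi> (word_class S R [(i, True)])) (\<phi> (word_class S R [(j, True)]))"
    and x: "x \<in> carrier (presented_group S R)" and y: "y \<in> carrier (presented_group S R)"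
  shows "commute G (\<phi> x) (\<phi> y)"
proof -
  let ?B = "presented_group S R" and ?w = "word_class S R"
  interpret B: group ?B by (rule group_presented_group)
  interpret G: group G by fact
  interpret group_hom ?B G \<phi>
    using hom by unfold_locales
  have carrier: "carrier ?B = ?w ` words S"
    by (simp add: presented_group_def)
  have gen: "?w [(i, b)] \<in> carrier ?B" if "i \<in> S" for i b
    using that by (auto simp: carrier words_def)
  have cent: "\<phi> ` carrier ?B \<subseteq> centralizer G g"
    if g: "g \<in> carrier G" and gens: "\<And>i. i \<in> S \<Longrightarrow> \<phi> (?w [(i, True)]) \<in> centralizer G g" for g
  proof -
    interpret C: subgroup "centralizer G g" G
      using g by (rule G.centralizer_subgroup)
    have letter: "\<phi> (?w [(i, b)]) \<in> centralizer G g" if i: "i \<in> S" for i b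
    proof (cases b)
      case True
      then show ?thesis using gens[OF i] by simp
    next
      case False
      have "?w [(i, False)] \<otimes>\<^bsub>?B\<^esub> ?w [(i, True)] = ?w [(i, False), (i, True)]"
        using i by (subst presented_group_mult) (auto simp: words_def)
      also have "\<dots> = \<one>\<^bsub>?B\<^esub>"
        using i word_equiv.cancel[OF i, of R False]
        by (simp add: presented_group_def word_class_eq_iff words_def)
      finally have "?w [(i, False)] = inv\<^bsub>?B\<^esub> ?w [(i, True)]"
        using gen[OF i] by (intro B.inv_equality[symmetric])
      then show ?thesis
        using False gens[OF i] gen[OF i] by simp
    qed
    have "\<phi> (?w u) \<in> centralizer G g" if "u \<in> words S" for u
      using that
    proof (induction u)
      case Nil
      have "?w [] = \<one>\<^bsub>?B\<^esub>" by (simp add: presented_group_def)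
      then show ?case by simp
    next
      case (Cons x u)
      obtain i b where x: "x = (i, b)" by (cases x)
      have i: "i \<in> S" and u: "u \<in> words S"
        using Cons.prems by (auto simp: words_def x)
      have "?w (x # u) = ?w [(i, b)] \<otimes>\<^bsub>?B\<^esub> ?w u"
        using i u by (subst presented_group_mult) (auto simp: words_def x)
      then show ?case
        using Cons.IH[OF u] letter[OF i] gen[OF i] u by (simp add: carrier)
    qed
    then show ?thesis by (auto simp: carrier)
  qed
  have "\<phi> ` carrier ?B \<subseteq> centralizer G (\<phi> (?w [(i, True)]))" if "i \<in> S" for i
    using that comm gen by (intro cent) (auto simp: centralizer_def)
  then have "\<phi> ` carrier ?B \<subseteq> centralizer G (\<phi> y)"
    using y gen by (intro cent) (auto simp: centralizer_def commute_sym)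
  then show ?thesis
    using x by (auto simp: centralizer_def)
qed

text \<open>A homomorphism with commuting values kills all commutators, and so it factors through the
  quotient by the derived subgroup.\<close>

lemma cyclic_hom_of_commute:
  assumes "group B" "group G" "\<phi> \<in> hom B G"
    and comm: "\<And>x y. x \<in> carrier B \<Longrightarrow> y \<in> carrier B \<Longrightarrow> commute G (\<phi> x) (\<phi> y)"
  shows "cyclic_hom B G \<phi>"
proof -
  interpret B: group B by fact
  interpret G: group G by fact
  interpret group_hom B G \<phi>
    using assms(3) by unfold_locales
  have "derived_set B (carrier B) \<subseteq> kernel B G \<phi>"
  proof clarify
    fix x y assume xy: "x \<in> carrier B" "y \<in> carrier B"
    then have "\<phi> x \<otimes>\<^bsub>G\<^esub> \<phi> y = \<phi> y \<otimes>\<^bsub>G\<^esub> \<phi> x"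
      using comm by (simp add: commute_def)
    then show "x \<otimes>\<^bsub>B\<^esub> y \<otimes>\<^bsub>B\<^esub> inv\<^bsub>B\<^esub> x \<otimes>\<^bsub>B\<^esub> inv\<^bsub>B\<^esub> y \<in> kernel B G \<phi>"
      using xy by (simp add: kernel_def G.m_assoc G.inv_solve_right')
  qed
  then have "derived B (carrier B) \<subseteq> kernel B G \<phi>"
    unfolding derived_def by (rule B.generate_subgroup_incl[OF _ subgroup_kernel])
  then obtain \<psi> where "\<psi> \<in> hom (B Mod derived B (carrier B)) G"
    "\<And>x. x \<in> carrier B \<Longrightarrow> \<psi> (derived B (carrier B) #>\<^bsub>B\<^esub> x) = \<phi> x"
    using FactGroup_universal_kernel[OF B.derived_self_is_normal] by metis
  then show ?thesis
    unfolding cyclic_hom_def by metis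
qed

lemma braid_tuple_of_hom:
  assumes hom: "\<phi> \<in> hom (braid_group n) G" and G: "group G"
  shows "braid_tuple G n (\<lambda>i. \<phi> (word_class {1..<n} (braid_relations n) [(i, True)]))"
proof -
  let ?B = "braid_group n" and ?w = "word_class {1..<n} (braid_relations n)"
  have mult: "\<phi> (?w (u @ v)) = \<phi> (?w u) \<otimes>\<^bsub>G\<^esub> \<phi> (?w v)"
    if "u \<in> words {1..<n}" "v \<in> words {1..<n}" for u v
  proof -
    have "?w u \<in> carrier ?B" "?w v \<in> carrier ?B"
      using that by (auto simp: braid_group_def presented_group_def)
    then show ?thesis
      using hom_mult[OF hom] presented_group_mult[OF that, of "braid_relations n"]
      by (metis braid_group_def)
  qed
  have rel: "?w u = ?w v" if "(u, v) \<in> braid_relations n" "u \<in> words {1..<n}" "v \<in> words {1..<n}" for u v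
    using that by (simp add: word_class_eq_iff word_equiv.rel)
  show ?thesis
  proof (intro braid_tuple.intro braid_tuple_axioms.intro G)
    fix i assume "i \<in> {1..<n}"
    then have "?w [(i, True)] \<in> carrier ?B"
      by (simp add: braid_group_def presented_group_def words_def)
    then show "\<phi> (?w [(i, True)]) \<in> carrier G"
      using hom by (auto simp: hom_def)
  next
    fix i j assume ij: "i \<in> {1..<n}" "j \<in> {1..<n}" "i + 2 \<le> j"
    have "?w ([(i, True)] @ [(j, True)]) = ?w ([(j, True)] @ [(i, True)])"
      using ij by (intro rel) (auto simp: words_def braid_relations_def)
    then show "commute G (\<phi> (?w [(i, True)])) (\<phi> (?w [(j, True)]))"
      using ij mult[of "[(i, True)]" "[(j, True)]"] mult[of "[(j, True)]" "[(i, True)]"]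
      by (simp add: commute_def words_def)
  next
    fix i assume i: "i \<in> {1..<n}" "i + 1 \<in> {1..<n}"
    have triple: "\<phi> (?w [(a, True), (b, True), (c, True)]) =
        \<phi> (?w [(a, True)]) \<otimes>\<^bsub>G\<^esub> \<phi> (?w [(b, True)]) \<otimes>\<^bsub>G\<^esub> \<phi> (?w [(c, True)])"
      if "a \<in> {1..<n}" "b \<in> {1..<n}" "c \<in> {1..<n}" for a b c
      using that mult[of "[(a, True), (b, True)]" "[(c, True)]"] mult[of "[(a, True)]" "[(b, True)]"]
      by (simp add: words_def)
    have "?w [(i, True), (i + 1, True), (i, True)] = ?w [(i + 1, True), (i, True), (i + 1, True)]"
      using i by (intro rel) (auto simp: words_def braid_relations_def)
    then show "\<phi> (?w [(i, True)]) \<otimes>\<^bsub>G\<^esub> \<phi> (?w [(i + 1, True)]) \<otimes>\<^bsub>G\<^esub> \<phi> (?w [(i, True)]) =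
        \<phi> (?w [(i + 1, True)]) \<otimes>\<^bsub>G\<^esub> \<phi> (?w [(i, True)]) \<otimes>\<^bsub>G\<^esub> \<phi> (?w [(i + 1, True)])"
      using triple[OF i(1) i(2) i(1)] triple[OF i(2) i(1) i(2)] by simp
  qed
qed

lemma braid_chain_of_noncyclic_quotient:
  assumes "noncyclic_quotient n G"
  shows "\<exists>s. braid_chain G n s"
proof -
  obtain \<phi> where G: "group G" and hom: "\<phi> \<in> hom (braid_group n) G"
    and noncyclic: "\<not> cyclic_hom (braid_group n) G \<phi>"
    using assms by (auto simp: noncyclic_quotient_def epi_def)
  define s where "s = (\<lambda>i. \<phi> (word_class {1..<n} (braid_relations n) [(i, True)]))"
  interpret braid_tuple G n s
    unfolding s_def using hom G by (rule braid_tuple_of_hom)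
  have "\<not> commute G (s i) (s (i + 1))" if i: "i \<in> {1..<n}" "i + 1 \<in> {1..<n}" for i
  proof
    assume "commute G (s i) (s (i + 1))"
    then have const: "s j = s i" if "j \<in> {1..<n}" for j
      using constant_of_adjacent_commute i that by blast
    have "cyclic_hom (braid_group n) G \<phi>"
    proof (rule cyclic_hom_of_commute[OF _ G hom])
      show "group (braid_group n)"
        by (simp add: braid_group_def group_presented_group)
      show "commute G (\<phi> x) (\<phi> y)" if "x \<in> carrier (braid_group n)" "y \<in> carrier (braid_group n)" for x y
        using presented_hom_commute[OF hom[unfolded braid_group_def] G _ that[unfolded braid_group_def]]
          const commute_refl unfolding s_def by metis
    qed
    then show False
      using noncyclic by simp
  qed
  then have "braid_chain G n s"
    by unfold_locales
  then show ?thesis by blast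
qed

theorem theorem2:
  fixes n :: nat and G :: "('a, 'b) monoid_scheme"
  assumes "n = 7"
    and "noncyclic_quotient n G"
  shows "infinite (carrier G) \<or> order G \<ge> fact n"
proof (cases "finite (carrier G)")
  case True
  obtain s where chain: "braid_chain G n s"
    using braid_chain_of_noncyclic_quotient[OF assms(2)] by blast
  interpret braid_chain G n s by fact
  have "centre G \<subseteq> carrier G" "\<one>\<^bsub>G\<^esub> \<in> centre G"
    using subgroup.subset[OF centre_subgroup] subgroup.one_closed[OF centre_subgroup] by auto
  then have "card (centre G) > 0"
    using True by (metis card_gt_0_iff empty_iff finite_subset)
  then have "fact n \<le> (fact n :: nat) * card (centre G)"
    by simp
  also have "\<dots> \<le> order G"
    using assms(1) True chain by (intro fact_mult_card_centre_le_order) auto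
  finally show ?thesis by simp
qed simp

end
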